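(* If $\clubsuit$ holds then there is a family $\{S_\beta:\beta<\omega_2\}$ of stationary subsets of $\omega_1$ which is almost disjoint (i.e. $S_\beta\cap S_\gamma$ is countable for $\beta\neq\gamma$); hence $\mathrm{NS}_{\omega_1}$ is not saturated. Consequently, it is consistent that Galvin's property fails and $\mathrm{NS}_{\omega_1}$ is not saturated.
   Context: $\clubsuit$ (tiltan) at $\aleph_1$: there is a sequence $\langle T_\alpha:\alpha\in\lim(\omega_1)\rangle$ such that each $T_\alpha$ is a cofinal subset of $\alpha$, and for every unbounded $A\subseteq\omega_1$ the set $\{\alpha: T_\alpha\subseteq A\}$ is stationary. An ideal $\mathcal{I}$ over $\omega_1$ is saturated iff in every collection $\{S_\alpha:\alpha<\omega_2\}$ of $\mathcal{I}$-positive sets there are distinct $\alpha,\beta$ with $S_\alpha\cap S_\beta\notin\mathcal{I}$; $\mathrm{NS}_{\omega_1}$ is the nonstationary ideal on $\omega_1$. Galvin's property (at $\aleph_1$): every collection $\{C_\alpha:\alpha<\omega_2\}$ of club subsets of $\omega_1$ has a subcollection $\{C_{\alpha_\beta}:\beta<\omega_1\}$ (distinct indices) whose intersection is a club of $\omega_1$. *)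

theory Defs
  imports Main "HOL-Library.Countable_Set"
begin

text \<open>omega_1 is represented by a well-ordered type 'a that is uncountable
  and all of whose proper initial segments are countable.  omega_2 is
  represented by a well-ordered type 'b that does not inject into 'a but
  all of whose proper initial segments inject into 'a.\<close>

definition is_omega1_type :: "'a::wellorder itself \<Rightarrow> bool" where
  "is_omega1_type _ \<longleftrightarrow> \<not> countable (UNIV :: 'a set) \<and> (\<forall>x::'a. countable {..<x})"

definition is_omega2_type :: "'b::wellorder itself \<Rightarrow> 'a itself \<Rightarrow> bool" where
  "is_omega2_type _ _ \<longleftrightarrow>
     \<not> (\<exists>f :: 'b \<Rightarrow> 'a. inj f) \<and> (\<forall>x::'b. \<exists>f :: 'b \<Rightarrow> 'a. inj_on f {..<x})"

definition limit_pt :: "'a::wellorder \<Rightarrow> bool" where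
  "limit_pt \<alpha> \<longleftrightarrow> (\<exists>\<beta>. \<beta> < \<alpha>) \<and> (\<forall>\<beta><\<alpha>. \<exists>\<gamma>. \<beta> < \<gamma> \<and> \<gamma> < \<alpha>)"

definition cofinal_in :: "'a::wellorder set \<Rightarrow> 'a \<Rightarrow> bool" where
  "cofinal_in T \<alpha> \<longleftrightarrow> T \<subseteq> {..<\<alpha>} \<and> (\<forall>\<beta><\<alpha>. \<exists>t\<in>T. \<beta> \<le> t)"

definition unbounded :: "'a::wellorder set \<Rightarrow> bool" where
  "unbounded A \<longleftrightarrow> (\<forall>\<beta>. \<exists>a\<in>A. \<beta> \<le> a)"

definition closed_set :: "'a::wellorder set \<Rightarrow> bool" where
  "closed_set C \<longleftrightarrow> (\<forall>\<alpha>. limit_pt \<alpha> \<and> (\<forall>\<beta><\<alpha>. \<exists>c\<in>C. \<beta> \<le> c \<and> c < \<alpha>) \<longrightarrow> \<alpha> \<in> C)"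

definition club :: "'a::wellorder set \<Rightarrow> bool" where
  "club C \<longleftrightarrow> closed_set C \<and> unbounded C"

definition stationary :: "'a::wellorder set \<Rightarrow> bool" where
  "stationary S \<longleftrightarrow> (\<forall>C. club C \<longrightarrow> S \<inter> C \<noteq> {})"

definition NS :: "'a::wellorder set set" where
  "NS = {A. \<not> stationary A}"

definition clubsuit :: "'a::wellorder itself \<Rightarrow> bool" where
  "clubsuit _ \<longleftrightarrow> (\<exists>T :: 'a \<Rightarrow> 'a set.
      (\<forall>\<alpha>. limit_pt \<alpha> \<longrightarrow> cofinal_in (T \<alpha>) \<alpha>) \<and>
      (\<forall>A. unbounded A \<longrightarrow> stationary {\<alpha>. limit_pt \<alpha> \<and> T \<alpha> \<subseteq> A}))"

definition saturated :: "'b itself \<Rightarrow> 'a set set \<Rightarrow> bool" where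
  "saturated _ I \<longleftrightarrow> (\<forall>S :: 'b \<Rightarrow> 'a set. (\<forall>\<alpha>. S \<alpha> \<notin> I) \<longrightarrow>
      (\<exists>\<alpha> \<beta>. \<alpha> \<noteq> \<beta> \<and> S \<alpha> \<inter> S \<beta> \<notin> I))"

end

theory Submission
  imports Defs
begin

text \<open>
  Let T be a clubsuit sequence. For every unbounded A in omega_1 the set
  S(A) of limits \<alpha> with T \<alpha> \<subseteq> A is stationary, and since each T \<alpha> is cofinal
  in \<alpha>, the intersection of S(A) and S(B) is bounded by any bound of A \<inter> B.
  So it suffices to have omega_2 uncountable subsets of omega_1 with pairwise
  countable intersections. These are the graphs, coded into omega_1 by a
  bijection of omega_1 \<times> omega_1 with omega_1, of omega_2 pairwise eventually
  different functions on omega_1; they are built by recursion, f \<beta> \<xi> avoiding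
  the countably many f \<gamma> \<xi> for those \<gamma> < \<beta> whose code under an
  injection of \<beta> into omega_1 lies below \<xi>. Countable sets being nonstationary,
  the family S witnesses that NS is not saturated.
\<close>

lemma countable_atMost_if_countable_lessThan:
  fixes x :: "'a::wellorder"
  assumes "\<forall>x::'a. countable {..<x}"
  shows "countable {..x}"
proof -
  have "{..x} = insert x {..<x}" by auto
  then show ?thesis using assms by simp
qed

lemma uncountable_imp_unbounded:
  assumes "\<forall>x::'a::wellorder. countable {..<x}" and "\<not> countable (A :: 'a set)"
  shows "unbounded A"
  unfolding unbounded_def
proof
  fix \<beta> :: 'a
  show "\<exists>a\<in>A. \<beta> \<le> a"
  proof (rule ccontr)
    assume "\<not> (\<exists>a\<in>A. \<beta> \<le> a)"
    then have "A \<subseteq> {..<\<beta>}" by (auto simp: not_le)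
    then show False using assms countable_subset by blast
  qed
qed

lemma omega1_countable_bounded:
  assumes "is_omega1_type TYPE('a::wellorder)" and "countable (X :: 'a set)"
  shows "\<exists>\<delta>. \<forall>x\<in>X. x < \<delta>"
proof (rule ccontr)
  assume unbounded: "\<not> (\<exists>\<delta>. \<forall>x\<in>X. x < \<delta>)"
  have "UNIV \<subseteq> (\<Union>x\<in>X. {..x})"
  proof
    fix z :: 'a
    from unbounded obtain y where "y \<in> X" "z \<le> y" by (auto simp: not_less)
    then show "z \<in> (\<Union>x\<in>X. {..x})" by auto
  qed
  moreover have "countable (\<Union>x\<in>X. {..x})"
    using assms countable_atMost_if_countable_lessThan unfolding is_omega1_type_def by auto
  ultimately show False
    using assms(1) countable_subset unfolding is_omega1_type_def by blast
qed

lemma omega1_countable_not_stationary: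
  assumes "is_omega1_type TYPE('a::wellorder)" and "countable (X :: 'a set)"
  shows "\<not> stationary X"
proof -
  have uncountable: "\<not> countable (UNIV :: 'a set)" and segments: "\<forall>x::'a. countable {..<x}"
    using assms(1) unfolding is_omega1_type_def by auto
  obtain \<delta> where bound: "\<forall>x\<in>X. x < \<delta>" using omega1_countable_bounded[OF assms] by blast
  have "closed_set {\<delta><..}"
    unfolding closed_set_def limit_pt_def by (metis greaterThan_iff order.strict_trans)
  moreover have "\<not> countable {\<delta><..}"
  proof
    assume "countable {\<delta><..}"
    moreover have "UNIV = {\<delta><..} \<union> {..\<delta>}" by auto
    ultimately show False
      using uncountable countable_atMost_if_countable_lessThan[OF segments]
      by (metis countable_Un)
  qed
  then have "unbounded {\<delta><..}" by (rule uncountable_imp_unbounded[OF segments])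
  moreover have "X \<inter> {\<delta><..} = {}" using bound by fastforce
  ultimately show ?thesis unfolding stationary_def club_def by blast
qed

lemma cofinal_in_bounded_imp_le:
  assumes "cofinal_in T \<alpha>" and "\<forall>t\<in>T. t < \<delta>"
  shows "\<alpha> \<le> \<delta>"
  using assms unfolding cofinal_in_def by (meson leD le_less_linear)

lemma guessed_sets_inter_countable:
  assumes "is_omega1_type TYPE('a::wellorder)"
    and "\<forall>\<alpha>. limit_pt \<alpha> \<longrightarrow> cofinal_in (T \<alpha>) (\<alpha> :: 'a)"
    and "countable (A \<inter> B)"
  shows "countable ({\<alpha>. limit_pt \<alpha> \<and> T \<alpha> \<subseteq> A} \<inter> {\<alpha>. limit_pt \<alpha> \<and> T \<alpha> \<subseteq> B})"
proof -
  obtain \<delta> where bound: "\<forall>x\<in>A \<inter> B. x < \<delta>"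
    using omega1_countable_bounded[OF assms(1,3)] by blast
  have "{\<alpha>. limit_pt \<alpha> \<and> T \<alpha> \<subseteq> A} \<inter> {\<alpha>. limit_pt \<alpha> \<and> T \<alpha> \<subseteq> B} \<subseteq> {..\<delta>}"
    using assms(2) bound cofinal_in_bounded_imp_le by fastforce
  then show ?thesis
    using assms(1) countable_atMost_if_countable_lessThan countable_subset
    unfolding is_omega1_type_def by blast
qed

lemma omega1_eventually_different_functions:
  assumes "is_omega1_type TYPE('a::wellorder)"
    and "\<forall>\<beta>::'b::wellorder. \<exists>i :: 'b \<Rightarrow> 'a. inj_on i {..<\<beta>}"
  shows "\<exists>f :: 'b \<Rightarrow> 'a \<Rightarrow> 'a. \<forall>\<beta> \<gamma>. \<gamma> < \<beta> \<longrightarrow> countable {\<xi>. f \<beta> \<xi> = f \<gamma> \<xi>}"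
proof -
  have uncountable: "\<not> countable (UNIV :: 'a set)" and segments: "\<forall>x::'a. countable {..<x}"
    using assms(1) unfolding is_omega1_type_def by auto
  define i :: "'b \<Rightarrow> 'b \<Rightarrow> 'a" where "i \<beta> = (SOME i. inj_on i {..<\<beta>})" for \<beta>
  define e :: "'b \<Rightarrow> 'a \<Rightarrow> 'b" where "e \<beta> = inv_into {..<\<beta>} (i \<beta>)" for \<beta>
  have e_i: "e \<beta> (i \<beta> \<gamma>) = \<gamma>" if "\<gamma> < \<beta>" for \<beta> \<gamma>
    unfolding e_def i_def using that assms(2) by (metis someI_ex inv_into_f_f lessThan_iff)
  define earlier :: "'b \<Rightarrow> 'a \<Rightarrow> 'a set" where
    "earlier \<beta> \<xi> = {\<eta>. \<eta> < \<xi> \<and> e \<beta> \<eta> < \<beta>}" for \<beta> \<xi>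
  define f :: "'b \<Rightarrow> 'a \<Rightarrow> 'a" where "f = wfrec {(x, y). x < y}
    (\<lambda>g \<beta> \<xi>. LEAST v. v \<notin> (\<lambda>\<eta>. g (e \<beta> \<eta>) \<xi>) ` earlier \<beta> \<xi>)"
  have f_eq: "f \<beta> \<xi> = (LEAST v. v \<notin> (\<lambda>\<eta>. f (e \<beta> \<eta>) \<xi>) ` earlier \<beta> \<xi>)" for \<beta> \<xi>
  proof -
    have "(\<lambda>\<eta>. cut f {(x, y). x < y} \<beta> (e \<beta> \<eta>) \<xi>) ` earlier \<beta> \<xi>
        = (\<lambda>\<eta>. f (e \<beta> \<eta>) \<xi>) ` earlier \<beta> \<xi>"
      by (auto simp: cut_def earlier_def)
    then show ?thesis
      unfolding f_def by (subst wfrec[OF wf]) simp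
  qed
  have f_differs: "f \<beta> \<xi> \<noteq> f \<gamma> \<xi>" if "\<gamma> < \<beta>" "i \<beta> \<gamma> < \<xi>" for \<beta> \<gamma> \<xi>
  proof -
    let ?used = "(\<lambda>\<eta>. f (e \<beta> \<eta>) \<xi>) ` earlier \<beta> \<xi>"
    have "countable ?used"
      using segments countable_subset[of "earlier \<beta> \<xi>" "{..<\<xi>}"] by (auto simp: earlier_def)
    then have "?used \<noteq> UNIV" using uncountable by auto
    then obtain w where "w \<notin> ?used" by blast
    then have "f \<beta> \<xi> \<notin> ?used" unfolding f_eq[of \<beta> \<xi>] by (rule LeastI)
    moreover have "f \<gamma> \<xi> \<in> ?used"
      using that e_i[OF that(1)] by (intro image_eqI[of _ _ "i \<beta> \<gamma>"]) (auto simp: earlier_def)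
    ultimately show ?thesis by metis
  qed
  have "countable {\<xi>. f \<beta> \<xi> = f \<gamma> \<xi>}" if "\<gamma> < \<beta>" for \<beta> \<gamma>
  proof -
    have "{\<xi>. f \<beta> \<xi> = f \<gamma> \<xi>} \<subseteq> {..i \<beta> \<gamma>}"
      using f_differs[OF that] by (auto simp: not_less[symmetric])
    then show ?thesis
      using countable_atMost_if_countable_lessThan[OF segments] countable_subset by blast
  qed
  then show ?thesis by blast
qed

lemma omega1_almost_disjoint_family:
  assumes "is_omega1_type TYPE('a::wellorder)"
    and "\<forall>\<beta>::'b::wellorder. \<exists>i :: 'b \<Rightarrow> 'a. inj_on i {..<\<beta>}"
  shows "\<exists>A :: 'b \<Rightarrow> 'a set. (\<forall>\<beta>. \<not> countable (A \<beta>)) \<and>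
           (\<forall>\<beta> \<gamma>. \<beta> \<noteq> \<gamma> \<longrightarrow> countable (A \<beta> \<inter> A \<gamma>))"
proof -
  have uncountable: "\<not> countable (UNIV :: 'a set)"
    using assms(1) unfolding is_omega1_type_def by auto
  obtain f :: "'b \<Rightarrow> 'a \<Rightarrow> 'a" where agree: "\<And>\<beta> \<gamma>. \<gamma> < \<beta> \<Longrightarrow> countable {\<xi>. f \<beta> \<xi> = f \<gamma> \<xi>}"
    using omega1_eventually_different_functions[OF assms] by blast
  have "infinite (UNIV :: 'a set)" using uncountable countable_finite by blast
  then obtain p :: "'a \<times> 'a \<Rightarrow> 'a" where "bij_betw p UNIV UNIV"
    using card_of_ordIso card_of_Times_same_infinite by fastforce
  then have p_inj: "p x = p y \<longleftrightarrow> x = y" for x y by (simp add: bij_betw_def inj_eq)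
  define A where "A \<beta> = range (\<lambda>\<xi>. p (\<xi>, f \<beta> \<xi>))" for \<beta>
  have "inj (\<lambda>\<xi>. p (\<xi>, f \<beta> \<xi>))" for \<beta> by (rule injI) (simp add: p_inj)
  then have "\<not> countable (A \<beta>)" for \<beta>
    unfolding A_def using uncountable countable_image_inj_on by blast
  moreover have "countable (A \<beta> \<inter> A \<gamma>)" if "\<beta> \<noteq> \<gamma>" for \<beta> \<gamma>
  proof -
    have "A \<beta> \<inter> A \<gamma> = (\<lambda>\<xi>. p (\<xi>, f \<beta> \<xi>)) ` {\<xi>. f \<beta> \<xi> = f \<gamma> \<xi>}"
      unfolding A_def by (auto simp: p_inj) (metis rangeI)
    moreover have "{\<xi>. f \<beta> \<xi> = f \<gamma> \<xi>} = {\<xi>. f \<gamma> \<xi> = f \<beta> \<xi>}" by auto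
    ultimately show ?thesis
      using that agree by (metis countable_image neqE)
  qed
  ultimately show ?thesis by blast
qed

lemma NS_not_saturated_if_almost_disjoint:
  fixes S :: "'b \<Rightarrow> 'a::wellorder set"
  assumes "is_omega1_type TYPE('a)"
    and "\<forall>\<beta>. stationary (S \<beta>)"
    and "\<forall>\<beta> \<gamma>. \<beta> \<noteq> \<gamma> \<longrightarrow> countable (S \<beta> \<inter> S \<gamma>)"
  shows "\<not> saturated TYPE('b) (NS :: 'a set set)"
proof -
  have "S \<beta> \<inter> S \<gamma> \<in> NS" if "\<beta> \<noteq> \<gamma>" for \<beta> \<gamma>
    using assms(3) that omega1_countable_not_stationary[OF assms(1)] by (simp add: NS_def)
  moreover have "S \<beta> \<notin> NS" for \<beta> using assms(2) by (simp add: NS_def)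
  ultimately show ?thesis unfolding saturated_def by blast
qed

theorem mainTheorem8:
  assumes "is_omega1_type TYPE('a::wellorder)"
    and "is_omega2_type TYPE('b::wellorder) TYPE('a)"
    and "clubsuit TYPE('a)"
  shows "(\<exists>S :: 'b \<Rightarrow> 'a set. (\<forall>\<beta>. stationary (S \<beta>)) \<and>
            (\<forall>\<beta> \<gamma>. \<beta> \<noteq> \<gamma> \<longrightarrow> countable (S \<beta> \<inter> S \<gamma>)))
         \<and> \<not> saturated TYPE('b) (NS :: 'a set set)"
proof -
  obtain A :: "'b \<Rightarrow> 'a set" where uncountable: "\<forall>\<beta>. \<not> countable (A \<beta>)"
    and almost_disjoint: "\<forall>\<beta> \<gamma>. \<beta> \<noteq> \<gamma> \<longrightarrow> countable (A \<beta> \<inter> A \<gamma>)"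
    using omega1_almost_disjoint_family[OF assms(1)] assms(2)
    unfolding is_omega2_type_def by blast
  obtain T :: "'a \<Rightarrow> 'a set" where cofinal: "\<forall>\<alpha>. limit_pt \<alpha> \<longrightarrow> cofinal_in (T \<alpha>) \<alpha>"
    and guessing: "\<forall>A. unbounded A \<longrightarrow> stationary {\<alpha>. limit_pt \<alpha> \<and> T \<alpha> \<subseteq> A}"
    using assms(3) unfolding clubsuit_def by blast
  define S where "S \<beta> = {\<alpha>. limit_pt \<alpha> \<and> T \<alpha> \<subseteq> A \<beta>}" for \<beta>
  have "\<forall>x::'a. countable {..<x}" using assms(1) unfolding is_omega1_type_def by blast
  then have stationary: "\<forall>\<beta>. stationary (S \<beta>)"
    unfolding S_def using guessing uncountable uncountable_imp_unbounded by blast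
  have almost_disjoint_S: "\<forall>\<beta> \<gamma>. \<beta> \<noteq> \<gamma> \<longrightarrow> countable (S \<beta> \<inter> S \<gamma>)"
    unfolding S_def using guessed_sets_inter_countable[OF assms(1) cofinal] almost_disjoint
    by simp
  show ?thesis
    using stationary almost_disjoint_S NS_not_saturated_if_almost_disjoint[OF assms(1)] by auto
qed

end
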